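(* Let $t_0\in\mathbb{Q}$ with $t_0\notin\{-1,0,1\}$, so that $t_0^{\pm1},t_0^{\pm3},t_0^{\pm5},t_0^{\pm7}$ is a nontrivial geometric progression, and let $n\ge 2$ be an integer. Then there exist infinitely many hyperelliptic curves $$C_m: y^2=a_mx^{2n}+b_mx^n+a_m,\qquad m\in\mathbb{Z}\setminus\{0\},\ a_m,b_m\in\mathbb{Q},$$ such that each of the numbers $t_0^{\pm i}$, $i=1,3,5,7$, is the $x$-coordinate of a rational point in $C_m(\mathbb{Q})$.
   Context: A hyperelliptic curve over $\mathbb{Q}$ is a curve given by $y^2=f(x)$ with $f\in\mathbb{Q}[x]$ of degree at least $3$ and without double roots; its set of rational points is $C(\mathbb{Q})=\{(x,y)\in\mathbb{Q}^2: y^2=f(x)\}$. *)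

theory Defs
  imports Complex_Main "HOL-Computational_Algebra.Computational_Algebra"
begin

text \<open>A hyperelliptic curve $y^2 = f(x)$ over the rationals is represented by $f$.
  Double roots are excluded in the algebraic closure, hence the passage to the complex numbers:
  a rational polynomial may have double roots none of which is rational.\<close>

definition hyperelliptic :: "rat poly \<Rightarrow> bool" where
  "hyperelliptic f \<longleftrightarrow> degree f \<ge> 3 \<and> rsquarefree (map_poly of_rat f :: complex poly)"

definition rational_points :: "rat poly \<Rightarrow> (rat \<times> rat) set" where
  "rational_points f = {(x, y). y\<^sup>2 = poly f x}"

definition palindromic_trinomial :: "nat \<Rightarrow> rat \<Rightarrow> rat \<Rightarrow> rat poly" where
  "palindromic_trinomial n a b = monom a (2 * n) + monom b n + [:a:]"

text \<open>The substitution $y \mapsto c y$ with rational $c \neq 0$ turns $y^2 = f(x)$ into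
  $y^2 = c^2 f(x)$. Equations related in this way present the same curve with the same
  $x$-coordinates of rational points, so they must not be counted as different curves:
  otherwise a single curve would already yield infinitely many.\<close>

definition same_curve :: "rat poly \<Rightarrow> rat poly \<Rightarrow> bool" where
  "same_curve f g \<longleftrightarrow> (\<exists>c. c \<noteq> 0 \<and> g = smult (c\<^sup>2) f)"

end

theory Submission
  imports Defs "HOL-Library.Countable"
begin

text \<open>
  Put $t = t_0^n$, $T = t^2$ and $s_i = t^i + t^{-i}$. At $x = t_0^{\pm i}$ the trinomial
  $a x^{2n} + b x^n + a$ equals $t^{\pm i} (a s_i + b)$, and $t \cdot t^{\pm i}$ is a square because
  $i$ is odd. So, after the factor $t$ has been split off from $a$ and $b$, it is enough that
  $a s_i + b$ is a square for $i = 1, 3, 5, 7$. Normalising $a s_7 + b = 1$ and dividing the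
  differences $s_7 - s_i$ by their common factor leaves one unknown $z$ and the condition that
  $1 - z d$ is a square for $d = d_1, d_3, d_5$, where $d_i$ is the polynomial \<open>gap1\<close>, \<open>gap3\<close> or
  \<open>gap5\<close> in $T$. Different $z$ give different curves, and only finitely many $z$ violate the
  hyperellipticity conditions $a \neq 0$ and $b^2 \neq 4 a^2$. Everything thus reduces to
  \<open>infinite_square_params\<close>: there are infinitely many such $z$.

  These $z$ come from the elliptic curve
  $E : y^2 = (x + d_3 d_5)(x + d_1 d_5)(x + d_1 d_3)$ with its point $R = (0, d_1 d_3 d_5)$.
  If $A \neq \pm R$ is a point at which all three factors are nonzero squares (doubles $A = 2P$
  have three square factors), then the
  chord through $A$ and $R$ meets $E$ in a third point, and its $x$-coordinate is
  $- d_1 d_3 d_5 z$ for an admissible $z$ (\<open>chord\<close>). A given $z$ arises from at most two values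
  of $x(A)$ (\<open>finite_chord_fibre\<close>). It remains to see that the points $2^k R$ are infinitely many.

  That $R$ has infinite order is seen at the prime 2. After a change of coordinates $E$ becomes
  $Y^2 = X (X + \alpha)(X + \beta)$ with $\alpha, \beta$ integral at 2. Once $X(P)$ has an even
  denominator, doubling $P$ lowers the 2-adic valuation of $X$ by exactly 2
  (\<open>duplication_2adic\<close>), so the points $2^k P$ are distinct. Replacing $t$ by $1/t$ if necessary,
  $t$ is integral at 2. If $t$ is even, the point $R$ itself has an even denominator in these
  coordinates; if $t$ is a unit, then $T \equiv 1$ modulo 8, and the point $4 R$ has one.
\<close>

section \<open>Rational numbers at the prime 2\<close>

definition int2 :: "rat set" where
  "int2 = {of_int a / of_int b | a b. odd b}"

definition unit2 :: "rat set" where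
  "unit2 = {of_int a / of_int b | a b. odd a \<and> odd b}"

lemma int2I: "odd b \<Longrightarrow> x = of_int a / of_int b \<Longrightarrow> x \<in> int2"
  by (auto simp: int2_def)

lemma unit2I: "odd a \<Longrightarrow> odd b \<Longrightarrow> x = of_int a / of_int b \<Longrightarrow> x \<in> unit2"
  by (auto simp: unit2_def)

lemma int2E:
  assumes "x \<in> int2"
  obtains a b where "odd b" "x = of_int a / of_int b" "of_int b \<noteq> (0::rat)"
  using assms unfolding int2_def by fastforce

lemma unit2E:
  assumes "x \<in> unit2"
  obtains a b where "odd a" "odd b" "x = of_int a / of_int b"
    "of_int a \<noteq> (0::rat)" "of_int b \<noteq> (0::rat)"
  using assms unfolding unit2_def by fastforce

lemma int2_add: "x \<in> int2 \<Longrightarrow> y \<in> int2 \<Longrightarrow> x + y \<in> int2"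
  by (elim int2E, rule_tac a = "a * ba + aa * b" and b = "b * ba" in int2I)
     (auto simp: field_simps)

lemma int2_mult: "x \<in> int2 \<Longrightarrow> y \<in> int2 \<Longrightarrow> x * y \<in> int2"
  by (elim int2E, rule_tac a = "a * aa" and b = "b * ba" in int2I) auto

lemma int2_of_int: "of_int a \<in> int2"
  by (rule int2I[of 1 _ a]) auto

lemma int2_numeral: "numeral k \<in> int2" "1 \<in> int2" "0 \<in> int2"
  using int2_of_int[of "numeral k"] int2_of_int[of 1] int2_of_int[of 0] by auto

lemma int2_minus: "x \<in> int2 \<Longrightarrow> - x \<in> int2"
  using int2_mult[OF int2_of_int[of "-1"]] by auto

lemma int2_diff: "x \<in> int2 \<Longrightarrow> y \<in> int2 \<Longrightarrow> x - y \<in> int2"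
  using int2_add[OF _ int2_minus] by fastforce

lemma int2_power: "x \<in> int2 \<Longrightarrow> x ^ k \<in> int2"
  by (induction k) (auto intro: int2_mult int2_numeral)

lemmas int2_intros = int2_add int2_mult int2_numeral int2_minus int2_diff int2_power

lemma unit2_mult: "x \<in> unit2 \<Longrightarrow> y \<in> unit2 \<Longrightarrow> x * y \<in> unit2"
  by (elim unit2E, rule_tac a = "a * aa" and b = "b * ba" in unit2I) auto

lemma unit2_inverse: "x \<in> unit2 \<Longrightarrow> inverse x \<in> unit2"
  by (elim unit2E, rule_tac a = b and b = a in unit2I) auto

lemma unit2_divide: "x \<in> unit2 \<Longrightarrow> y \<in> unit2 \<Longrightarrow> x / y \<in> unit2"
  by (simp add: divide_inverse unit2_mult unit2_inverse)

lemma unit2_1: "1 \<in> unit2"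
  by (rule unit2I[of 1 1]) auto

lemma unit2_power: "x \<in> unit2 \<Longrightarrow> x ^ k \<in> unit2"
  by (induction k) (auto intro: unit2_mult unit2_1)

lemma unit2_int2: "x \<in> unit2 \<Longrightarrow> x \<in> int2"
  by (auto simp: unit2_def int2_def)

lemma unit2_nonzero: "x \<in> unit2 \<Longrightarrow> x \<noteq> 0"
  by (auto simp: unit2_def)

text \<open>The ring of rationals with odd denominator is local with maximal ideal generated by 2, so
  a perturbation by a multiple of 2 preserves units.\<close>

lemma unit2_add_even:
  assumes "u \<in> unit2" "r \<in> int2"
  shows "u + 2 * r \<in> unit2"
proof -
  obtain a b where ab: "odd a" "odd b" "u = of_int a / of_int b" "of_int b \<noteq> (0::rat)"
    using assms(1) by (rule unit2E)
  obtain c d where cd: "odd d" "r = of_int c / of_int d" "of_int d \<noteq> (0::rat)"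
    using assms(2) by (rule int2E)
  show ?thesis
    by (rule unit2I[of "a * d + 2 * c * b" "b * d"])
       (use ab(1,2,4) cd(1,3) in \<open>auto simp: ab(3) cd(2) field_simps\<close>)
qed

lemma unit2_one_plus: "r \<in> int2 \<Longrightarrow> x = 1 + 2 * r \<Longrightarrow> x \<in> unit2"
  using unit2_add_even[OF unit2_1] by simp

lemma even_notin_unit2:
  assumes "r \<in> int2" shows "2 * r \<notin> unit2"
proof
  assume "2 * r \<in> unit2"
  then obtain a b where ab: "odd a" "odd b" "2 * r = of_int a / of_int b" "of_int b \<noteq> (0::rat)"
    by (rule unit2E)
  obtain c d where cd: "odd d" "r = of_int c / of_int d" "of_int d \<noteq> (0::rat)"
    using assms by (rule int2E)
  have "of_int (2 * c * b) = (of_int (a * d) :: rat)"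
    using ab cd by (simp add: field_simps)
  hence "2 * c * b = a * d" by (simp only: of_int_eq_iff)
  thus False using ab cd by (metis even_mult_iff even_numeral)
qed

text \<open>The 2-adic valuation, here of numbers with nonpositive valuation, is well defined. It tells
  the members of a doubling orbit apart.\<close>

lemma unit2_over_power_inj:
  assumes "u \<in> unit2" "v \<in> unit2" "u / 2 ^ i = v / 2 ^ j"
  shows "i = j"
proof -
  have False if "x \<in> unit2" "y \<in> unit2" "x / 2 ^ k = y / 2 ^ l" "k < l" for x y k l
  proof -
    obtain e where e: "l = k + Suc e" using less_imp_Suc_add[OF \<open>k < l\<close>] by auto
    have "y = 2 * (2 ^ e * x)" using that(3) by (simp add: e power_add field_simps)
    thus False
      using that even_notin_unit2[of "2 ^ e * x"] by (auto intro: int2_intros unit2_int2)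
  qed
  from this[OF assms] this[OF assms(2,1) assms(3)[symmetric]] show ?thesis
    by (meson linorder_neqE_nat)
qed

lemma odd_square_int:
  assumes "odd (a :: int)"
  obtains c where "a\<^sup>2 = 1 + 8 * c"
proof -
  obtain k where k: "a = 2 * k + 1" using assms by (elim oddE)
  have "even (k * (k + 1))" by simp
  then obtain c where "k * (k + 1) = 2 * c" by (elim evenE)
  hence "a\<^sup>2 = 1 + 8 * c" by (simp add: k power2_eq_square algebra_simps)
  thus ?thesis using that by blast
qed

lemma unit2_square:
  assumes "u \<in> unit2"
  obtains r where "r \<in> int2" "u\<^sup>2 = 1 + 8 * r"
proof -
  obtain a b where ab: "odd a" "odd b" "u = of_int a / of_int b" "of_int b \<noteq> (0::rat)"
    using assms by (rule unit2E)
  obtain c1 c2 where "a\<^sup>2 = 1 + 8 * c1" "b\<^sup>2 = 1 + 8 * c2"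
    using odd_square_int ab by metis
  then obtain c where c: "a\<^sup>2 = b\<^sup>2 + 8 * c" using that[of "c1 - c2"] by simp
  have "u\<^sup>2 = of_int (a\<^sup>2) / of_int (b\<^sup>2)" using ab by (simp add: power_divide)
  also have "\<dots> = 1 + 8 * (of_int c / of_int (b\<^sup>2))"
    unfolding c using ab by (simp add: field_simps)
  finally have "u\<^sup>2 = 1 + 8 * (of_int c / of_int (b\<^sup>2))" .
  moreover have "of_int c / of_int (b\<^sup>2) \<in> int2" by (rule int2I[of "b\<^sup>2" _ c]) (use ab in auto)
  ultimately show ?thesis using that by blast
qed

lemma int_odd_part:
  assumes "(a::int) \<noteq> 0"
  obtains k c where "odd c" "a = 2 ^ k * c"
proof -
  have "\<not> is_unit (2 :: int)" by simp
  thus ?thesis using multiplicity_decompose'[of a 2] assms that by metis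
qed

text \<open>The disjunction separates the numbers that are integral at 2 from those whose inverse is.\<close>

lemma rat_odd_part:
  assumes "(t::rat) \<noteq> 0"
  obtains u k where "u \<in> unit2" "t = u * 2 ^ k \<or> t = u / 2 ^ k"
proof -
  obtain a b where ab: "t = of_int a / of_int b" "b > 0"
    using quotient_of_div[of t] quotient_of_denom_pos[of t] by (metis prod.collapse)
  have "a \<noteq> 0" "b \<noteq> 0" using assms ab by auto
  obtain k c where kc: "odd c" "a = 2 ^ k * c" using int_odd_part[OF \<open>a \<noteq> 0\<close>] .
  obtain l d where ld: "odd d" "b = 2 ^ l * d" using int_odd_part[OF \<open>b \<noteq> 0\<close>] .
  have u: "of_int c / of_int d \<in> unit2" using kc ld by (intro unit2I[of c d]) auto
  have nz: "of_int d \<noteq> (0::rat)" using ld by auto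
  show ?thesis
  proof (cases "l \<le> k")
    case True
    then obtain e where "k = l + e" using le_Suc_ex by blast
    hence "t = of_int c / of_int d * 2 ^ e"
      using ab kc ld nz by (simp add: power_add field_simps)
    thus ?thesis using u that by blast
  next
    case False
    then obtain e where "l = k + e" using le_Suc_ex nat_le_linear by blast
    hence "t = of_int c / of_int d / 2 ^ e"
      using ab kc ld nz by (simp add: power_add field_simps)
    thus ?thesis using u that by blast
  qed
qed

text \<open>Adding a number of nonnegative valuation to one of negative valuation changes only the unit
  part.\<close>

lemma unit2_over_power_add:
  assumes "w \<in> unit2" "j \<ge> 1" "\<alpha> \<in> int2"
  obtains w' where "w' \<in> unit2" "w / 2 ^ j + \<alpha> = w' / 2 ^ j"
proof
  obtain i where j: "j = Suc i" using assms(2) by (cases j) auto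
  have "w + \<alpha> * 2 ^ j = w + 2 * (\<alpha> * 2 ^ i)" by (simp add: j)
  moreover have "\<alpha> * 2 ^ i \<in> int2" using assms by (intro int2_intros)
  ultimately show "w + \<alpha> * 2 ^ j \<in> unit2"
    using unit2_add_even[OF assms(1)] by metis
  show "w / 2 ^ j + \<alpha> = (w + \<alpha> * 2 ^ j) / 2 ^ j" by (simp add: field_simps)
qed

definition cong8 :: "rat \<Rightarrow> rat \<Rightarrow> bool" where
  "cong8 x y \<longleftrightarrow> (\<exists>a\<in>int2. x = y + 8 * a)"

lemma cong8_refl: "cong8 x x"
  unfolding cong8_def by (rule bexI[of _ 0]) (auto intro: int2_numeral)

lemma cong8_add:
  assumes "cong8 x p" "cong8 y q"
  shows "cong8 (x + y) (p + q)"
proof -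
  obtain a b where ab: "a \<in> int2" "b \<in> int2" "x = p + 8 * a" "y = q + 8 * b"
    using assms unfolding cong8_def by auto
  have "a + b \<in> int2" by (intro int2_intros ab)
  moreover have "x + y = p + q + 8 * (a + b)" by (simp add: ab)
  ultimately show ?thesis unfolding cong8_def by blast
qed

lemma cong8_mult:
  assumes "cong8 x p" "cong8 y q" "p \<in> int2" "q \<in> int2"
  shows "cong8 (x * y) (p * q)"
proof -
  obtain a b where ab: "a \<in> int2" "b \<in> int2" "x = p + 8 * a" "y = q + 8 * b"
    using assms unfolding cong8_def by auto
  have "p * b + q * a + 8 * a * b \<in> int2" by (intro int2_intros ab assms)
  moreover have "x * y = p * q + 8 * (p * b + q * a + 8 * a * b)" by (simp add: ab algebra_simps)
  ultimately show ?thesis unfolding cong8_def by blast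
qed

lemma cong8_power:
  assumes "cong8 x p" "p \<in> int2"
  shows "cong8 (x ^ n) (p ^ n)"
  by (induction n) (auto intro!: cong8_refl cong8_mult assms int2_power)

section \<open>Doubling on an elliptic curve with full 2-torsion\<close>

text \<open>The duplication formula: the point $2 (X, Y)$ has first coordinate $v_1^2$, and for each
  root $e$ of the cubic the difference of that coordinate and $e$ is the square of
  $((X - e)^2 - (e - e')(e - e'')) / (2 Y)$, where $e', e''$ are the other two roots.\<close>

lemma duplication:
  fixes X Y \<alpha> \<beta> :: "'a :: field_char_0"
  assumes Y: "Y\<^sup>2 = X * (X + \<alpha>) * (X + \<beta>)" "Y \<noteq> 0"
  defines "v1 \<equiv> (X\<^sup>2 - \<alpha> * \<beta>) / (2 * Y)"
  shows "((X\<^sup>2 + 2 * \<alpha> * X + \<alpha> * \<beta>) / (2 * Y))\<^sup>2 = v1\<^sup>2 + \<alpha>"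
    and "((X\<^sup>2 + 2 * \<beta> * X + \<alpha> * \<beta>) / (2 * Y))\<^sup>2 = v1\<^sup>2 + \<beta>"
proof -
  have eq: "v1\<^sup>2 + e = ((X\<^sup>2 - \<alpha> * \<beta>)\<^sup>2 + 4 * e * (X * (X + \<alpha>) * (X + \<beta>))) / (4 * Y\<^sup>2)" for e
    unfolding v1_def Y(1)[symmetric] using Y(2)
    by (simp add: power_divide power_mult_distrib add_divide_distrib)
  have eq': "(c / (2 * Y))\<^sup>2 = c\<^sup>2 / (4 * Y\<^sup>2)" for c
    by (simp add: power_divide power_mult_distrib)
  show "((X\<^sup>2 + 2 * \<alpha> * X + \<alpha> * \<beta>) / (2 * Y))\<^sup>2 = v1\<^sup>2 + \<alpha>"
    unfolding eq eq' by (rule arg_cong[of _ _ "\<lambda>c. c / _"]) algebra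
  show "((X\<^sup>2 + 2 * \<beta> * X + \<alpha> * \<beta>) / (2 * Y))\<^sup>2 = v1\<^sup>2 + \<beta>"
    unfolding eq eq' by (rule arg_cong[of _ _ "\<lambda>c. c / _"]) algebra
qed

text \<open>When the valuation of $X$ is $-j < 0$, the numerator $(X^2 - \alpha \beta)^2$ has valuation
  $-4 j$ and the denominator $4 Y^2$ has valuation $2 - 3 j$, since each of the three factors of
  $Y^2$ has valuation $-j$. Hence the new valuation is $-(j + 2)$.\<close>

lemma duplication_2adic:
  assumes "\<alpha> \<in> int2" "\<beta> \<in> int2" "w \<in> unit2" "j \<ge> 1"
    and Y: "Y\<^sup>2 = X * (X + \<alpha>) * (X + \<beta>)" and X: "X = w / 2 ^ j"
  obtains v1 v2 v3 w' where "w' \<in> unit2" "v1\<^sup>2 = w' / 2 ^ (j + 2)"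
    "v2\<^sup>2 = v1\<^sup>2 + \<alpha>" "v3\<^sup>2 = v1\<^sup>2 + \<beta>"
proof -
  obtain wa where wa: "wa \<in> unit2" "X + \<alpha> = wa / 2 ^ j"
    using unit2_over_power_add[OF assms(3,4,1)] X by auto
  obtain wb where wb: "wb \<in> unit2" "X + \<beta> = wb / 2 ^ j"
    using unit2_over_power_add[OF assms(3,4,2)] X by auto
  have "w\<^sup>2 \<in> unit2" "2 * j \<ge> 1" "- (\<alpha> * \<beta>) \<in> int2"
    using assms by (auto intro: unit2_power int2_intros)
  then obtain c where c: "c \<in> unit2" "w\<^sup>2 / 2 ^ (2 * j) + - (\<alpha> * \<beta>) = c / 2 ^ (2 * j)"
    by (rule unit2_over_power_add)
  have num: "X\<^sup>2 - \<alpha> * \<beta> = c / 2 ^ (2 * j)"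
    using c(2) by (simp add: X power_divide power_mult[symmetric] mult.commute)
  have nz: "w \<noteq> 0" "wa \<noteq> 0" "wb \<noteq> 0"
    using unit2_nonzero assms(3) wa(1) wb(1) by auto
  have Yw: "Y\<^sup>2 = w * wa * wb / 2 ^ (3 * j)"
    unfolding Y wa(2) wb(2) by (simp add: X power_add[symmetric])
  hence "Y \<noteq> 0" using nz by auto
  have "((X\<^sup>2 - \<alpha> * \<beta>) / (2 * Y))\<^sup>2 = (c / 2 ^ (2 * j))\<^sup>2 / (4 * (w * wa * wb / 2 ^ (3 * j)))"
    unfolding num Yw[symmetric] by (simp add: power_divide power_mult_distrib)
  also have "\<dots> = c\<^sup>2 / (w * wa * wb) / 2 ^ (j + 2)"
  proof -
    have p: "(2::rat) ^ (2 * j) = (2 ^ j)\<^sup>2" "(2::rat) ^ (3 * j) = (2 ^ j) ^ 3"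
      by (simp_all add: power_mult[symmetric] mult.commute)
    show ?thesis
      unfolding p power_add using nz by (simp add: field_simps power2_eq_square power3_eq_cube)
  qed
  finally have "((X\<^sup>2 - \<alpha> * \<beta>) / (2 * Y))\<^sup>2 = c\<^sup>2 / (w * wa * wb) / 2 ^ (j + 2)" .
  moreover have "c\<^sup>2 / (w * wa * wb) \<in> unit2"
    using c wa wb assms(3) by (intro unit2_divide unit2_power unit2_mult)
  ultimately show ?thesis
    using duplication[OF Y \<open>Y \<noteq> 0\<close>] that by metis
qed

text \<open>The values come from the points $2^k P$ with $k \geq 1$: being doubles, they make all three
  factors squares, and their valuations $-(j + 2 k)$ are distinct.\<close>

lemma infinite_square_triples:
  assumes "\<alpha> \<in> int2" "\<beta> \<in> int2" "w \<in> unit2" "j \<ge> 1"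
    and "Y\<^sup>2 = X * (X + \<alpha>) * (X + \<beta>)" "X = w / 2 ^ j"
  shows "infinite {X. \<exists>v1 v2 v3. v1 \<noteq> 0 \<and> v2 \<noteq> 0 \<and> v3 \<noteq> 0 \<and>
    v1\<^sup>2 = X \<and> v2\<^sup>2 = X + \<alpha> \<and> v3\<^sup>2 = X + \<beta>}" (is "infinite ?S")
proof -
  have orbit: "\<exists>v1 v2 v3 w'. w' \<in> unit2 \<and> v1\<^sup>2 = w' / 2 ^ (j + 2 + 2 * n) \<and>
      v2\<^sup>2 = v1\<^sup>2 + \<alpha> \<and> v3\<^sup>2 = v1\<^sup>2 + \<beta>" for n
  proof (induction n)
    case 0
    show ?case using duplication_2adic[OF assms] by (metis add.right_neutral mult_0_right)
  next
    case (Suc n)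
    then obtain v1 v2 v3 w' where v: "w' \<in> unit2" "v1\<^sup>2 = w' / 2 ^ (j + 2 + 2 * n)"
      "v2\<^sup>2 = v1\<^sup>2 + \<alpha>" "v3\<^sup>2 = v1\<^sup>2 + \<beta>" by blast
    have "(v1 * v2 * v3)\<^sup>2 = v1\<^sup>2 * (v1\<^sup>2 + \<alpha>) * (v1\<^sup>2 + \<beta>)"
      using v by (simp add: power_mult_distrib)
    moreover have "1 \<le> j + 2 + 2 * n" by simp
    ultimately obtain v1' v2' v3' w'' where "w'' \<in> unit2" "v1'\<^sup>2 = w'' / 2 ^ (j + 2 + 2 * n + 2)"
      "v2'\<^sup>2 = v1'\<^sup>2 + \<alpha>" "v3'\<^sup>2 = v1'\<^sup>2 + \<beta>"
      using duplication_2adic[OF assms(1,2) v(1) _ _ v(2)] by metis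
    moreover have "j + 2 + 2 * Suc n = j + 2 + 2 * n + 2" by simp
    ultimately show ?case by metis
  qed
  have "\<forall>n. \<exists>X. X \<in> ?S \<and> (\<exists>w'\<in>unit2. X = w' / 2 ^ (j + 2 + 2 * n))"
  proof
    fix n
    obtain v1 v2 v3 w' where v: "w' \<in> unit2" "v1\<^sup>2 = w' / 2 ^ (j + 2 + 2 * n)"
      "v2\<^sup>2 = v1\<^sup>2 + \<alpha>" "v3\<^sup>2 = v1\<^sup>2 + \<beta>" using orbit by blast
    have j: "1 \<le> j + 2 + 2 * n" by simp
    have nz: "v1\<^sup>2 + \<gamma> \<noteq> 0" if \<gamma>: "\<gamma> \<in> int2" for \<gamma>
    proof -
      obtain w'' where "w'' \<in> unit2" "v1\<^sup>2 + \<gamma> = w'' / 2 ^ (j + 2 + 2 * n)"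
        using unit2_over_power_add[OF v(1) j \<gamma>] unfolding v(2) by blast
      thus ?thesis using unit2_nonzero by simp
    qed
    have "v1 \<noteq> 0" using nz[OF int2_numeral(3)] by simp
    moreover have "v2 \<noteq> 0" using nz[OF assms(1)] unfolding v(3)[symmetric] by simp
    moreover have "v3 \<noteq> 0" using nz[OF assms(2)] unfolding v(4)[symmetric] by simp
    ultimately have "v1\<^sup>2 \<in> ?S" using v(3,4) by blast
    thus "\<exists>X. X \<in> ?S \<and> (\<exists>w'\<in>unit2. X = w' / 2 ^ (j + 2 + 2 * n))" using v(1,2) by blast
  qed
  from choice[OF this] obtain X' where X': "\<And>n. X' n \<in> ?S"
    "\<And>n. \<exists>w'\<in>unit2. X' n = w' / 2 ^ (j + 2 + 2 * n)" by blast
  have "inj X'"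
  proof (rule injI)
    fix m n assume "X' m = X' n"
    moreover obtain u where u: "u \<in> unit2" "X' m = u / 2 ^ (j + 2 + 2 * m)"
      using X'(2)[of m] by blast
    moreover obtain v where v: "v \<in> unit2" "X' n = v / 2 ^ (j + 2 + 2 * n)"
      using X'(2)[of n] by blast
    ultimately have "u / 2 ^ (j + 2 + 2 * m) = v / 2 ^ (j + 2 + 2 * n)" by simp
    from unit2_over_power_inj[OF u(1) v(1) this] show "m = n" by simp
  qed
  hence inf: "infinite (range X')" by (rule range_inj_infinite)
  have "range X' \<subseteq> ?S" by (rule image_subsetI) (rule X'(1))
  thus ?thesis using inf by (rule infinite_super)
qed

section \<open>The chord through a fixed rational point\<close>

text \<open>Let $m$ be the slope of the chord through $R = (0, d_1 d_2 d_3)$ and the point with first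
  coordinate $x$ on $y^2 = (x + d_2 d_3)(x + d_1 d_3)(x + d_1 d_2)$. The hypothesis on $m$ says that
  the chord passes through that point, and $- d_1 d_2 d_3 z$ is the first coordinate of its third
  intersection with the curve. Comparing the cubic with the square of the chord at the root
  $- d_2 d_3$ shows that the product of the three values of the factor $x + d_2 d_3$ is
  $(d_2 d_3 (d_1 - m))^2$; two of them are $u_1^2$ and, at $R$, $d_2 d_3$.\<close>

lemma chord_square:
  fixes d1 d2 d3 :: "'a :: field_char_0"
  assumes "u1 \<noteq> 0" "d2 * d3 \<noteq> 0" "u1\<^sup>2 = x + d2 * d3"
    and m: "m\<^sup>2 * x = x\<^sup>2 + (d2 * d3 + d1 * d3 + d1 * d2) * x
       + d1 * d2 * d3 * (d1 + d2 + d3) - 2 * (d1 * d2 * d3) * m"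
    and z: "d1 * d2 * d3 * z = x + (d2 * d3 + d1 * d3 + d1 * d2) - m\<^sup>2"
  shows "1 - z * d1 = ((d1 - m) / u1)\<^sup>2"
proof -
  have "(d2 * d3) * (u1\<^sup>2 * (1 - z * d1)) = (d2 * d3) * (d1 - m)\<^sup>2"
    unfolding assms(3) using m z by algebra
  hence "u1\<^sup>2 * (1 - z * d1) = (d1 - m)\<^sup>2" using assms(2) by simp
  thus ?thesis using assms(1) by (simp add: power_divide field_simps)
qed

text \<open>The last equation is what remains of the chord after its slope
  $m = (d_1 + d_2 + d_3 + z x) / 2$ has been eliminated. It bounds the number of $x$ that lead to
  the same $z$.\<close>

lemma chord:
  fixes d1 d2 d3 :: "'a :: field_char_0"
  assumes nz: "u1 \<noteq> 0" "u2 \<noteq> 0" "u3 \<noteq> 0" "d1 \<noteq> 0" "d2 \<noteq> 0" "d3 \<noteq> 0" "x \<noteq> 0"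
    and u: "u1\<^sup>2 = x + d2 * d3" "u2\<^sup>2 = x + d1 * d3" "u3\<^sup>2 = x + d1 * d2"
  obtains z where "\<exists>y. 1 - z * d1 = y\<^sup>2" "\<exists>y. 1 - z * d2 = y\<^sup>2" "\<exists>y. 1 - z * d3 = y\<^sup>2"
    "(d1 + d2 + d3 + z * x)\<^sup>2 = 4 * (x + (d2 * d3 + d1 * d3 + d1 * d2) - d1 * d2 * d3 * z)"
proof -
  define m where "m = (u1 * u2 * u3 - d1 * d2 * d3) / x"
  define z where "z = (x + (d2 * d3 + d1 * d3 + d1 * d2) - m\<^sup>2) / (d1 * d2 * d3)"
  have mx: "m * x = u1 * u2 * u3 - d1 * d2 * d3" using nz by (simp add: m_def)
  have "x * (m\<^sup>2 * x) = x * (x\<^sup>2 + (d2 * d3 + d1 * d3 + d1 * d2) * x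
       + d1 * d2 * d3 * (d1 + d2 + d3) - 2 * (d1 * d2 * d3) * m)"
    using mx u by algebra
  hence m: "m\<^sup>2 * x = x\<^sup>2 + (d2 * d3 + d1 * d3 + d1 * d2) * x
       + d1 * d2 * d3 * (d1 + d2 + d3) - 2 * (d1 * d2 * d3) * m"
    using nz by simp
  have z: "d1 * d2 * d3 * z = x + (d2 * d3 + d1 * d3 + d1 * d2) - m\<^sup>2"
    using nz by (simp add: z_def)
  have s1: "1 - z * d1 = ((d1 - m) / u1)\<^sup>2"
    by (rule chord_square[OF _ _ u(1) m z]) (use nz in auto)
  have s2: "1 - z * d2 = ((d2 - m) / u2)\<^sup>2"
    by (rule chord_square[OF _ _ u(2)]) (use nz m z in \<open>auto simp: algebra_simps\<close>)
  have s3: "1 - z * d3 = ((d3 - m) / u3)\<^sup>2"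
    by (rule chord_square[OF _ _ u(3)]) (use nz m z in \<open>auto simp: algebra_simps\<close>)
  have "d1 * d2 * d3 * (2 * m) = d1 * d2 * d3 * (d1 + d2 + d3 + z * x)"
    using m z by algebra
  hence "2 * m = d1 + d2 + d3 + z * x" using nz by simp
  hence "(d1 + d2 + d3 + z * x)\<^sup>2 = (2 * m)\<^sup>2" by simp
  also have "\<dots> = 4 * m\<^sup>2" by (simp add: power_mult_distrib)
  also have "m\<^sup>2 = x + (d2 * d3 + d1 * d3 + d1 * d2) - d1 * d2 * d3 * z"
    using z by simp
  finally show ?thesis using that s1 s2 s3 by blast
qed

lemma finite_chord_fibre:
  fixes z \<sigma> S p :: rat
  shows "finite {x. (\<sigma> + z * x)\<^sup>2 = 4 * (x + S - p * z)}"
proof -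
  let ?q = "[:\<sigma>\<^sup>2 - 4 * S + 4 * p * z, 2 * \<sigma> * z - 4, z\<^sup>2:]"
  have "?q \<noteq> 0" by auto
  hence "finite {x. poly ?q x = 0}" by (rule poly_roots_finite)
  moreover have "{x. (\<sigma> + z * x)\<^sup>2 = 4 * (x + S - p * z)} \<subseteq> {x. poly ?q x = 0}"
    by (auto simp: power2_eq_square algebra_simps)
  ultimately show ?thesis by (rule finite_subset[rotated])
qed

section \<open>The curve attached to the progression, and a point of infinite order\<close>

text \<open>These are the quotients $t^7 (s_7 - s_i) / ((1 - T)^2 (1 + T))$ for $i = 1, 3, 5$, where
  $T = t^2$, $s_i = t^i + t^{-i}$ and
  $t^7 (s_7 - s_i) = (1 - t^{7 - i})(1 - t^{7 + i})$. Without the common factor they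
  do not degenerate at 2: they are units for even $t$, and for a unit $t$ they are 6, 5 and 3
  modulo 8.\<close>

definition gap1 :: "rat \<Rightarrow> rat" where "gap1 T = (1 + T + T\<^sup>2) * (1 + T\<^sup>2)"
definition gap3 :: "rat \<Rightarrow> rat" where "gap3 T = 1 + T + T\<^sup>2 + T ^ 3 + T ^ 4"
definition gap5 :: "rat \<Rightarrow> rat" where "gap5 T = 1 + T\<^sup>2 + T ^ 4"

lemmas gap_defs = gap1_def gap3_def gap5_def

lemma gap1_eq:
  "gap1 T = gap3 T + T\<^sup>2"
  "gap1 T = gap5 T + T * (1 + T + T\<^sup>2)"
  by (simp_all add: gap_defs algebra_simps eval_nat_numeral)

text \<open>In the coordinate $X = (x + d_3 d_5) / T$ the roots become $0$, $-\alpha$ and $-\beta$ with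
  $\alpha = T d_5$ and $\beta = (1 + T + T^2) d_3$, which are integral at 2. The point
  $R = (0, d_1 d_3 d_5)$ gets $X = d_3 d_5 / T$, and for even $t$ the factors $d_3$ and $d_5$ are
  units because they are 1 modulo $T$.\<close>

lemma starting_point_even:
  assumes "u \<in> unit2" "k \<ge> 1" "t = u * 2 ^ k" "T = t\<^sup>2"
  obtains X Y w j where "w \<in> unit2" "j \<ge> 1" "X = w / 2 ^ j"
    "Y\<^sup>2 = X * (X + T * gap5 T) * (X + (1 + T + T\<^sup>2) * gap3 T)"
proof
  obtain i where k: "k = Suc i" using assms(2) by (cases k) auto
  define r where "r = u\<^sup>2 * 2 ^ (2 * i + 1)"
  have T: "T = 2 * r" unfolding assms(3,4) r_def k by (simp add: power_mult_distrib power_even_eq power2_eq_square)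
  have r: "r \<in> int2" unfolding r_def by (intro int2_intros unit2_int2[OF assms(1)])
  hence Ti: "T \<in> int2" unfolding T by (intro int2_intros)
  have nz: "u \<noteq> 0" "t \<noteq> 0" "T \<noteq> 0" using unit2_nonzero assms by auto
  have "gap3 T \<in> unit2"
  proof (rule unit2_one_plus)
    show "r * (1 + T + T\<^sup>2 + T ^ 3) \<in> int2" by (intro int2_intros r Ti)
    show "gap3 T = 1 + 2 * (r * (1 + T + T\<^sup>2 + T ^ 3))" unfolding gap3_def using T by algebra
  qed
  moreover have "gap5 T \<in> unit2"
  proof (rule unit2_one_plus)
    show "r * (T + T ^ 3) \<in> int2" by (intro int2_intros r Ti)
    show "gap5 T = 1 + 2 * (r * (T + T ^ 3))" unfolding gap5_def using T by algebra
  qed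
  ultimately show "gap3 T * gap5 T / u\<^sup>2 \<in> unit2"
    using assms(1) by (intro unit2_divide unit2_mult unit2_power)
  show "2 * k \<ge> 1" using assms by simp
  show "gap3 T * gap5 T / T = gap3 T * gap5 T / u\<^sup>2 / 2 ^ (2 * k)"
    unfolding assms(3,4) by (simp add: power_mult_distrib power_even_eq)
  have "(gap1 T * gap3 T * gap5 T / t ^ 3)\<^sup>2 = (gap1 T * gap3 T * gap5 T)\<^sup>2 / T ^ 3"
    by (simp add: power_divide assms(4) power_mult[symmetric])
  also have "\<dots> = gap3 T * gap5 T / T * (gap1 T * gap5 T / T) * (gap1 T * gap3 T / T)"
    using nz by (simp add: power2_eq_square power3_eq_cube field_simps)
  also have "gap1 T * gap5 T / T = gap3 T * gap5 T / T + T * gap5 T"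
    unfolding gap1_eq(1) using nz by (simp add: field_simps power2_eq_square)
  also have "gap1 T * gap3 T / T = gap3 T * gap5 T / T + (1 + T + T\<^sup>2) * gap3 T"
    unfolding gap1_eq(2) using nz by (simp add: field_simps)
  finally show "(gap1 T * gap3 T * gap5 T / t ^ 3)\<^sup>2 = gap3 T * gap5 T / T
    * (gap3 T * gap5 T / T + T * gap5 T) * (gap3 T * gap5 T / T + (1 + T + T\<^sup>2) * gap3 T)" .
qed


text \<open>For a unit $t$ the same point $R$ is integral at 2, and so is $2 R$: the first coordinate of
  the latter is $h^2 / T$ with $h = (1 + T^4) / 2$. Doubling once more brings in the powers
  of 2. Since $T \equiv 1$ modulo 8, the numerator $h^4 - T^2 \alpha \beta$ is
  $1 - 3 \cdot 3 \cdot 5 = -44$ modulo 8, hence 4 times a unit, while the second coordinate of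
  $2 R$ is 8 times a unit. So $X(4 R)$ has valuation $2 \cdot (2 - 4) = -4$.\<close>

lemma starting_point_odd:
  assumes "t \<in> unit2" "T = t\<^sup>2"
  obtains X Y w j where "w \<in> unit2" "j \<ge> 1" "X = w / 2 ^ j"
    "Y\<^sup>2 = X * (X + T * gap5 T) * (X + (1 + T + T\<^sup>2) * gap3 T)"
proof -
  define \<alpha> \<beta> where "\<alpha> = T * gap5 T" and "\<beta> = (1 + T + T\<^sup>2) * gap3 T"
  obtain r where r: "r \<in> int2" "T = 1 + 8 * r" using unit2_square assms by metis
  have Tu: "T \<in> unit2" using assms by (simp add: unit2_power)
  have Ti: "T \<in> int2" using Tu by (rule unit2_int2)
  have nz: "t \<noteq> 0" "T \<noteq> 0" using unit2_nonzero assms Tu by auto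
  define f g h where "f = (1 + T) / 2" and "g = (1 + T\<^sup>2) / 2" and "h = (1 + T ^ 4) / 2"
  hence f2: "2 * f = 1 + T" and g2: "2 * g = 1 + T\<^sup>2" and h2: "2 * h = 1 + T ^ 4" by simp_all
  have f: "f \<in> unit2"
  proof (rule unit2_one_plus)
    show "2 * r \<in> int2" by (intro int2_intros r)
    show "f = 1 + 2 * (2 * r)" by (simp add: f_def r(2))
  qed
  have g: "g \<in> unit2"
  proof (rule unit2_one_plus)
    show "2 * r * (T + 1) \<in> int2" by (intro int2_intros r Ti)
    show "g = 1 + 2 * (2 * r * (T + 1))" by (simp add: g_def r(2) power2_eq_square algebra_simps)
  qed
  have h: "h \<in> unit2"
  proof (rule unit2_one_plus)
    show "2 * r * (1 + T + T\<^sup>2 + T ^ 3) \<in> int2" by (intro int2_intros r Ti)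
    have "2 * h = 2 * (1 + 2 * (2 * r * (1 + T + T\<^sup>2 + T ^ 3)))"
      using h2 r(2) by algebra
    thus "h = 1 + 2 * (2 * r * (1 + T + T\<^sup>2 + T ^ 3))" by simp
  qed
  \<comment> \<open>The point $2 R$.\<close>
  define X Y where "X = h\<^sup>2 / T" and "Y = 8 * (h * g ^ 3 * f\<^sup>2) / t ^ 3"
  have X\<alpha>: "X + \<alpha> = (2 * g\<^sup>2)\<^sup>2 / T"
  proof -
    have "4 * (h\<^sup>2 + T\<^sup>2 * gap5 T) = 4 * (2 * g\<^sup>2)\<^sup>2"
      unfolding gap5_def using h2 g2 by algebra
    hence "(2 * g\<^sup>2)\<^sup>2 = h\<^sup>2 + T\<^sup>2 * gap5 T" by simp
    thus ?thesis using nz by (simp add: X_def \<alpha>_def add_divide_distrib power2_eq_square)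
  qed
  have X\<beta>: "X + \<beta> = (4 * g * f\<^sup>2)\<^sup>2 / T"
  proof -
    have "4 * (h\<^sup>2 + T * ((1 + T + T\<^sup>2) * gap3 T)) = 4 * (4 * g * f\<^sup>2)\<^sup>2"
      unfolding gap3_def using h2 g2 f2 by algebra
    hence "(4 * g * f\<^sup>2)\<^sup>2 = h\<^sup>2 + T * ((1 + T + T\<^sup>2) * gap3 T)" by simp
    thus ?thesis using nz by (simp add: X_def \<beta>_def add_divide_distrib)
  qed
  have "Y \<noteq> 0" unfolding Y_def using f g h nz unit2_nonzero by auto
  have Y: "Y\<^sup>2 = X * (X + \<alpha>) * (X + \<beta>)"
  proof -
    have "Y\<^sup>2 = (8 * (h * g ^ 3 * f\<^sup>2))\<^sup>2 / T ^ 3"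
      by (simp add: Y_def assms(2) power_divide power_mult[symmetric])
    also have "(8 * (h * g ^ 3 * f\<^sup>2))\<^sup>2 = h\<^sup>2 * (2 * g\<^sup>2)\<^sup>2 * (4 * g * f\<^sup>2)\<^sup>2"
      by algebra
    also have "\<dots> / T ^ 3 = X * (X + \<alpha>) * (X + \<beta>)"
      unfolding X\<alpha> X\<beta> by (simp add: X_def power3_eq_cube)
    finally show ?thesis .
  qed
  \<comment> \<open>The point $4 R$.\<close>
  define X' where "X' = ((X\<^sup>2 - \<alpha> * \<beta>) / (2 * Y))\<^sup>2"
  obtain va vb where v: "va\<^sup>2 = X' + \<alpha>" "vb\<^sup>2 = X' + \<beta>"
    using duplication[OF Y \<open>Y \<noteq> 0\<close>] unfolding X'_def by metis
  define Y' where "Y' = (X\<^sup>2 - \<alpha> * \<beta>) / (2 * Y) * va * vb"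
  have Y': "Y'\<^sup>2 = X' * (X' + \<alpha>) * (X' + \<beta>)"
    unfolding Y'_def by (simp only: v power_mult_distrib X'_def[symmetric])
  have "cong8 T 1" "cong8 (h\<^sup>2) 1"
    using r unit2_square[OF h] unfolding cong8_def by blast+
  moreover from this have "cong8 (T ^ 3 * (gap5 T * ((1 + T + T\<^sup>2) * gap3 T)))
      (1 ^ 3 * ((1 + 1\<^sup>2 + 1 ^ 4) * ((1 + 1 + 1\<^sup>2) * (1 + 1 + 1\<^sup>2 + 1 ^ 3 + 1 ^ 4))))"
    unfolding gap_defs by (intro cong8_mult cong8_add cong8_power cong8_refl int2_intros)
  ultimately obtain a b where ab: "a \<in> int2" "b \<in> int2"
    "h\<^sup>2 = 1 + 8 * a" "T ^ 3 * (gap5 T * ((1 + T + T\<^sup>2) * gap3 T)) = 45 + 8 * b"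
    unfolding cong8_def by auto
  \<comment> \<open>The odd number with $(1 + 8 a)^2 - (45 + 8 b) = 4 e$.\<close>
  define e where "e = 1 + 2 * (2 * a + 8 * a\<^sup>2 - b - 6)"
  have e: "e \<in> unit2"
    by (rule unit2_one_plus[OF _ e_def]) (intro int2_intros ab)
  have "T\<^sup>2 * (X\<^sup>2 - \<alpha> * \<beta>) = (h\<^sup>2)\<^sup>2 - T ^ 3 * (gap5 T * ((1 + T + T\<^sup>2) * gap3 T))"
  proof -
    have "T * X = h\<^sup>2" using nz by (simp add: X_def)
    thus ?thesis unfolding \<alpha>_def \<beta>_def by algebra
  qed
  also have "\<dots> = 4 * e"
    unfolding ab(3,4) e_def by algebra
  finally have num: "X\<^sup>2 - \<alpha> * \<beta> = 4 * e / T\<^sup>2" using nz by (simp add: field_simps)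
  define w where "w = (e * t ^ 3 / (T\<^sup>2 * (h * g ^ 3 * f\<^sup>2)))\<^sup>2"
  have "w \<in> unit2"
    unfolding w_def by (intro unit2_power unit2_divide unit2_mult e f g h Tu assms)
  moreover have "X' = w / 2 ^ 4"
  proof -
    have "(X\<^sup>2 - \<alpha> * \<beta>) / (2 * Y) = e * t ^ 3 / (T\<^sup>2 * (h * g ^ 3 * f\<^sup>2)) / 4"
      unfolding num Y_def by simp
    thus ?thesis unfolding X'_def w_def by (simp only: power_divide) simp
  qed
  ultimately show ?thesis
    using that[of w 4 X' Y'] Y' unfolding \<alpha>_def \<beta>_def by simp
qed


definition square_params :: "rat \<Rightarrow> rat set" where
  "square_params T = {z. \<forall>d\<in>{gap1 T, gap3 T, gap5 T}. \<exists>y. 1 - z * d = y\<^sup>2}"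

lemma gap_pos: "gap1 (t\<^sup>2) > 0" "gap3 (t\<^sup>2) > 0" "gap5 (t\<^sup>2) > 0"
  unfolding gap_defs by (auto intro!: add_pos_nonneg mult_pos_pos)

text \<open>Infinitely many $X$ from the doubling orbit are moved back to the coordinate
  $x = T X - d_3 d_5$ and sent to $z$ by the chord. Since every $z$ has a finite fibre, infinitely
  many $z$ occur. The value $x = 0$ is left out because there the chord through $R$ is not
  determined.\<close>

lemma infinite_square_params_integral:
  assumes "u \<in> unit2" "t = u * 2 ^ k"
  shows "infinite (square_params (t\<^sup>2))"
proof -
  define T where "T = t\<^sup>2"
  define g1 g3 g5 where "g1 = gap1 T" and "g3 = gap3 T" and "g5 = gap5 T"
  define \<alpha> \<beta> where "\<alpha> = T * g5" and "\<beta> = (1 + T + T\<^sup>2) * g3"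
  have nz: "g1 \<noteq> 0" "g3 \<noteq> 0" "g5 \<noteq> 0"
    unfolding g1_def g3_def g5_def T_def using gap_pos[of t] by simp_all
  have t: "t \<noteq> 0" "T \<noteq> 0" using assms unit2_nonzero by (auto simp: T_def)
  have Ti: "T \<in> int2"
    unfolding T_def assms(2) by (intro int2_intros unit2_int2[OF assms(1)])
  obtain X Y w j where start: "w \<in> unit2" "j \<ge> 1" "X = w / 2 ^ j"
    "Y\<^sup>2 = X * (X + \<alpha>) * (X + \<beta>)"
  proof (cases "k = 0")
    case True
    with assms have "t \<in> unit2" by simp
    thus ?thesis
      by (rule starting_point_odd[OF _ T_def]) (rule that[unfolded \<alpha>_def \<beta>_def g3_def g5_def])
  next
    case False
    hence "k \<ge> 1" by simp
    thus ?thesis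
      by (rule starting_point_even[OF assms(1) _ assms(2) T_def])
         (rule that[unfolded \<alpha>_def \<beta>_def g3_def g5_def])
  qed
  have \<alpha>\<beta>: "\<alpha> \<in> int2" "\<beta> \<in> int2"
    unfolding \<alpha>_def \<beta>_def g3_def g5_def gap_defs by (intro int2_intros Ti)+
  define S where "S = {X. \<exists>v1 v2 v3. v1 \<noteq> 0 \<and> v2 \<noteq> 0 \<and> v3 \<noteq> 0 \<and>
    v1\<^sup>2 = X \<and> v2\<^sup>2 = X + \<alpha> \<and> v3\<^sup>2 = X + \<beta>}"
  have "infinite S"
    unfolding S_def by (rule infinite_square_triples[OF \<alpha>\<beta> start(1,2,4,3)])
  moreover have "inj_on (\<lambda>X. T * X - g3 * g5) S" using t by (auto intro!: inj_onI)
  ultimately have "infinite ((\<lambda>X. T * X - g3 * g5) ` S)" using finite_imageD by blast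
  hence inf: "infinite ((\<lambda>X. T * X - g3 * g5) ` S - {0})" by simp
  define fibre where "fibre z = {x. (g1 + g3 + g5 + z * x)\<^sup>2 =
    4 * (x + (g3 * g5 + g1 * g5 + g1 * g3) - g1 * g3 * g5 * z)}" for z
  have "\<exists>z\<in>square_params T. x \<in> fibre z"
    if x: "x \<in> (\<lambda>X. T * X - g3 * g5) ` S - {0}" for x
  proof -
    obtain v1 v2 v3 where v: "v1 \<noteq> 0" "v2 \<noteq> 0" "v3 \<noteq> 0"
      "v2\<^sup>2 = v1\<^sup>2 + \<alpha>" "v3\<^sup>2 = v1\<^sup>2 + \<beta>" "x = T * v1\<^sup>2 - g3 * g5" "x \<noteq> 0"
      using x unfolding S_def by auto
    have u: "(t * v1)\<^sup>2 = x + g3 * g5" "(t * v2)\<^sup>2 = x + g1 * g5" "(t * v3)\<^sup>2 = x + g1 * g3"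
    proof -
      show "(t * v1)\<^sup>2 = x + g3 * g5"
        by (simp add: power_mult_distrib v(6) T_def)
      have "g1 = g3 + T\<^sup>2" "g1 = g5 + T * (1 + T + T\<^sup>2)"
        unfolding g1_def g3_def g5_def by (rule gap1_eq)+
      thus "(t * v2)\<^sup>2 = x + g1 * g5" "(t * v3)\<^sup>2 = x + g1 * g3"
        unfolding power_mult_distrib v(4,5,6) \<alpha>_def \<beta>_def T_def[symmetric] by algebra+
    qed
    have "t * v1 \<noteq> 0" "t * v2 \<noteq> 0" "t * v3 \<noteq> 0" using v t by auto
    from chord[OF this nz v(7) u] obtain z where
      "\<exists>y. 1 - z * g1 = y\<^sup>2" "\<exists>y. 1 - z * g3 = y\<^sup>2" "\<exists>y. 1 - z * g5 = y\<^sup>2" "x \<in> fibre z"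
      unfolding fibre_def by blast
    thus ?thesis unfolding square_params_def g1_def g3_def g5_def by blast
  qed
  hence sub: "(\<lambda>X. T * X - g3 * g5) ` S - {0} \<subseteq> (\<Union>z\<in>square_params T. fibre z)" by blast
  have "finite (fibre z)" for z unfolding fibre_def by (rule finite_chord_fibre)
  hence "infinite (square_params T)" using inf finite_subset[OF sub] by blast
  thus ?thesis unfolding T_def .
qed

text \<open>The three polynomials are palindromic of degree 4, which reflects the invariance of $s_i$
  under $t \mapsto 1/t$.\<close>

lemma gap_inverse:
  assumes "T \<noteq> 0"
  shows "gap1 (inverse T) = gap1 T / T ^ 4" "gap3 (inverse T) = gap3 T / T ^ 4"
    "gap5 (inverse T) = gap5 T / T ^ 4"
  using assms by (simp_all add: gap_defs field_simps eval_nat_numeral)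

lemma infinite_square_params:
  assumes "t \<noteq> 0"
  shows "infinite (square_params (t\<^sup>2))"
proof -
  obtain u k where u: "u \<in> unit2" "t = u * 2 ^ k \<or> t = u / 2 ^ k"
    using rat_odd_part[OF assms] .
  show ?thesis
  proof (cases "t = u * 2 ^ k")
    case True
    thus ?thesis using infinite_square_params_integral u by blast
  next
    case False
    hence "inverse t = inverse u * 2 ^ k" using u by (simp add: divide_inverse)
    hence inf: "infinite (square_params ((inverse t)\<^sup>2))"
      using infinite_square_params_integral unit2_inverse u by blast
    define T where "T = t\<^sup>2"
    have T: "T \<noteq> 0" using assms by (simp add: T_def)
    have "z / T ^ 4 \<in> square_params T" if "z \<in> square_params (inverse T)" for z
      using that unfolding square_params_def gap_inverse[OF T] by simp
    hence "(\<lambda>z. z / T ^ 4) ` square_params (inverse T) \<subseteq> square_params T" by blast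
    moreover have "inj_on (\<lambda>z. z / T ^ 4) (square_params (inverse T))"
      using T by (auto intro!: inj_onI)
    ultimately show ?thesis
      using inf finite_subset finite_imageD unfolding T_def power_inverse by metis
  qed
qed

section \<open>Palindromic trinomials\<close>

lemma poly_palindromic_trinomial:
  "poly (palindromic_trinomial n a b) x = a * (x ^ n)\<^sup>2 + b * x ^ n + a"
  by (simp add: palindromic_trinomial_def poly_monom power_even_eq power_mult mult.commute)

text \<open>At a multiple root $x$ the number $P = x^n$ would be a root of $a P^2 + b P + a$ and, as
  $P \neq 0$, of its derivative $2 a P + b$; but the discriminant of the quadratic is
  $b^2 - 4 a^2$.\<close>

lemma hyperelliptic_palindromic_trinomial:
  assumes "n \<ge> 2" "a \<noteq> 0" "b\<^sup>2 \<noteq> 4 * a\<^sup>2"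
  shows "hyperelliptic (palindromic_trinomial n a b)"
proof -
  let ?f = "palindromic_trinomial n a b"
  let ?F = "map_poly of_rat ?f :: complex poly"
  have "coeff ?f (2 * n) = a" using assms by (simp add: palindromic_trinomial_def coeff_pCons split: nat.split)
  hence "degree ?f \<ge> 2 * n" using assms(2) by (metis le_degree)
  hence deg: "degree ?f \<ge> 3" using assms(1) by simp
  define A B :: complex where "A = of_rat a" and "B = of_rat b"
  have F: "?F = monom A (2 * n) + monom B n + [:A:]"
    by (rule poly_eqI) (simp add: palindromic_trinomial_def A_def B_def coeff_map_poly of_rat_add coeff_pCons split: nat.split)
  have A: "A \<noteq> 0" using assms by (simp add: A_def)
  have AB: "B\<^sup>2 \<noteq> 4 * A\<^sup>2"
  proof
    assume "B\<^sup>2 = 4 * A\<^sup>2"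
    hence "(of_rat (b\<^sup>2) :: complex) = of_rat (4 * a\<^sup>2)"
      by (simp add: A_def B_def of_rat_power of_rat_mult)
    thus False using assms(3) by (simp only: of_rat_eq_iff)
  qed
  have "\<not> (poly ?F x = 0 \<and> poly (pderiv ?F) x = 0)" for x
  proof
    assume asm: "poly ?F x = 0 \<and> poly (pderiv ?F) x = 0"
    define P where "P = x ^ n"
    have 1: "A * P\<^sup>2 + B * P + A = 0"
      using asm unfolding F by (simp add: poly_monom P_def power_even_eq power_mult mult.commute)
    hence P: "P \<noteq> 0" using A by auto
    have "x * poly (pderiv ?F) x = of_nat n * (2 * A * P\<^sup>2 + B * P)"
    proof -
      obtain k where k: "n = Suc k" using assms(1) by (cases n) auto
      have "pderiv ?F = monom (of_nat (2 * n) * A) (2 * n - 1) + monom (of_nat n * B) (n - 1)"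
        unfolding F by (simp add: pderiv_add pderiv_monom pderiv_pCons)
      hence "x * poly (pderiv ?F) x = of_nat (2 * n) * A * (x * x ^ (2 * n - 1))
          + of_nat n * B * (x * x ^ (n - 1))"
        by (simp add: poly_monom distrib_left mult.left_commute)
      also have "x * x ^ (2 * n - 1) = P\<^sup>2"
        by (simp add: P_def k power2_eq_square mult_2 flip: power_add power_Suc)
      also have "x * x ^ (n - 1) = P" by (simp add: P_def k)
      finally show ?thesis by (simp add: distrib_left)
    qed
    hence "2 * A * P\<^sup>2 + B * P = 0" using asm assms(1) by simp
    hence "P * (2 * A * P + B) = 0" by algebra
    hence 2: "2 * A * P + B = 0" using P by simp
    have "B\<^sup>2 = 4 * A\<^sup>2" using 1 2 by algebra
    with AB show False by contradiction
  qed
  hence "rsquarefree ?F" by (simp add: rsquarefree_roots)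
  with deg show ?thesis by (simp add: hyperelliptic_def)
qed

lemma rational_point_if_square:
  assumes "x ^ n = q" "q \<noteq> 0" "t * q = r\<^sup>2" "a * (q + inverse q) + b = w\<^sup>2"
  shows "\<exists>y. (x, y) \<in> rational_points (palindromic_trinomial n (t * a) (t * b))"
proof -
  have "inverse q * q = 1" using assms by simp
  hence "(r * w)\<^sup>2 = t * a * q\<^sup>2 + t * b * q + t * a"
    using assms(3,4) by algebra
  thus ?thesis
    by (intro exI[of _ "r * w"])
       (simp add: rational_points_def poly_palindromic_trinomial assms(1))
qed

lemma same_curve_palindromic_trinomial:
  assumes "n \<ge> 1" "same_curve (palindromic_trinomial n a b) (palindromic_trinomial n a' b')"
  obtains c where "a' = c\<^sup>2 * a" "b' = c\<^sup>2 * b"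
proof -
  obtain c where c: "palindromic_trinomial n a' b' = smult (c\<^sup>2) (palindromic_trinomial n a b)"
    using assms(2) unfolding same_curve_def by blast
  have coeffs: "coeff (palindromic_trinomial n p q) 0 = p" "coeff (palindromic_trinomial n p q) n = q" for p q
    using assms(1) by (auto simp: palindromic_trinomial_def coeff_pCons split: nat.split)
  have "a' = c\<^sup>2 * a" "b' = c\<^sup>2 * b"
    using arg_cong[OF c, of "\<lambda>f. coeff f 0"] arg_cong[OF c, of "\<lambda>f. coeff f n"]
    by (simp_all add: coeffs)
  thus ?thesis using that by blast
qed

section \<open>Infinitely many curves through the progression\<close>

theorem corollary3p4:
  fixes t0 :: rat and n :: nat
  assumes "t0 \<notin> {-1, 0, 1}" and "n \<ge> 2"
  shows "\<exists>a b :: int \<Rightarrow> rat.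
    (\<forall>m. m \<noteq> 0 \<longrightarrow>
      hyperelliptic (palindromic_trinomial n (a m) (b m)) \<and>
      (\<forall>i \<in> {1, 3, 5, 7 :: int}.
        (\<exists>y. (t0 powi i, y) \<in> rational_points (palindromic_trinomial n (a m) (b m))) \<and>
        (\<exists>y. (t0 powi (- i), y) \<in> rational_points (palindromic_trinomial n (a m) (b m))))) \<and>
    (\<forall>m m'. m \<noteq> 0 \<longrightarrow> m' \<noteq> 0 \<longrightarrow> m \<noteq> m' \<longrightarrow>
      \<not> same_curve (palindromic_trinomial n (a m) (b m)) (palindromic_trinomial n (a m') (b m')))"
proof -
  define t where "t = t0 ^ n"
  define T where "T = t\<^sup>2"
  have t: "t \<noteq> 0" using assms by (simp add: t_def)
  have "T \<noteq> 1"
  proof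
    assume "T = 1"
    hence "\<bar>t\<bar> = 1" by (auto simp: T_def power2_eq_1_iff)
    hence "\<bar>t0\<bar> ^ n = 1" by (simp add: t_def power_abs)
    hence "\<bar>t0\<bar> = 1" using assms(2) power_eq_iff_eq_base[of n "\<bar>t0\<bar>" 1] by simp
    thus False using assms(1) by auto
  qed
  moreover have "1 + T > 0" unfolding T_def by (intro add_pos_nonneg) auto
  ultimately have T: "1 - T \<noteq> 0" "1 + T \<noteq> 0" by auto
  define s where "s i = t ^ i + inverse (t ^ i)" for i :: nat
  define C where "C = t ^ 7 / ((1 - T)\<^sup>2 * (1 + T))"
  have C0: "C \<noteq> 0" using t T by (simp add: C_def)
  have gap: "C * (s 7 - s 1) = gap1 T" "C * (s 7 - s 3) = gap3 T" "C * (s 7 - s 5) = gap5 T"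
  proof -
    have inv: "inverse t * t = 1" using t by simp
    have D: "(1 - T)\<^sup>2 * (1 + T) \<noteq> 0" using T by simp
    have "t ^ 7 * (s 7 - s 1) = gap1 T * ((1 - T)\<^sup>2 * (1 + T))"
      "t ^ 7 * (s 7 - s 3) = gap3 T * ((1 - T)\<^sup>2 * (1 + T))"
      "t ^ 7 * (s 7 - s 5) = gap5 T * ((1 - T)\<^sup>2 * (1 + T))"
      unfolding s_def gap_defs T_def power_inverse[symmetric] using inv by algebra+
    thus "C * (s 7 - s 1) = gap1 T" "C * (s 7 - s 3) = gap3 T" "C * (s 7 - s 5) = gap5 T"
      unfolding C_def using D by (simp_all add: nonzero_divide_eq_eq)
  qed
  \<comment> \<open>The removed values are those with $a = 0$, $b = 2 a$ or $b = -2 a$. If one of the last two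
    denominators vanishes, the corresponding equation has no solution.\<close>
  define Z where "Z = square_params T - {0, inverse (C * (s 7 + 2)), inverse (C * (s 7 - 2))}"
  have "infinite Z"
    unfolding Z_def T_def using infinite_square_params[OF t] by simp
  then obtain g :: "nat \<Rightarrow> rat" where g: "inj g" "range g \<subseteq> Z"
    using infinite_countable_subset by blast
  define z where "z m = g (to_nat m)" for m :: int
  have zZ: "z m \<in> Z" for m using g(2) by (auto simp: z_def)
  have z_inj: "m = m'" if "z m = z m'" for m m'
    using that injD[OF g(1), of "to_nat m" "to_nat m'"] by (simp add: z_def)
  define a b where "a m = C * z m" and "b m = 1 - a m * s 7" for m
  have hyp: "hyperelliptic (palindromic_trinomial n (t * a m) (t * b m))" for m
  proof (rule hyperelliptic_palindromic_trinomial[OF assms(2)])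
    show "t * a m \<noteq> 0" using t C0 zZ[of m] by (simp add: a_def Z_def)
    have ne: "z m * (C * (s 7 + 2)) \<noteq> 1" "z m * (C * (s 7 - 2)) \<noteq> 1"
      using zZ[of m] inverse_unique[of "C * (s 7 + 2)" "z m"] inverse_unique[of "C * (s 7 - 2)" "z m"]
      by (auto simp: Z_def mult.commute)
    have "b m - 2 * a m \<noteq> 0" "b m + 2 * a m \<noteq> 0"
      using ne by (auto simp: a_def b_def algebra_simps)
    hence "t\<^sup>2 * ((b m - 2 * a m) * (b m + 2 * a m)) \<noteq> 0" using t by simp
    thus "(t * b m)\<^sup>2 \<noteq> 4 * (t * a m)\<^sup>2" by (simp add: power2_eq_square algebra_simps)
  qed
  have points: "(\<exists>y. (t0 powi i, y) \<in> rational_points (palindromic_trinomial n (t * a m) (t * b m))) \<and>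
        (\<exists>y. (t0 powi (- i), y) \<in> rational_points (palindromic_trinomial n (t * a m) (t * b m)))"
    if i: "i \<in> {1, 3, 5, 7}" for m i
  proof -
    have "\<exists>w. a m * s j + b m = w\<^sup>2" if "j \<in> {1, 3, 5, 7}" for j
    proof -
      have "a m * s j + b m = 1 - z m * (C * (s 7 - s j))"
        by (simp add: a_def b_def algebra_simps)
      moreover have "\<exists>w. 1 - z m * (C * (s 7 - s j)) = w\<^sup>2"
      proof (cases "j = 7")
        case True
        thus ?thesis by (intro exI[of _ 1]) simp
      next
        case False
        hence "C * (s 7 - s j) \<in> {gap1 T, gap3 T, gap5 T}" using that gap by auto
        thus ?thesis using zZ[of m] unfolding Z_def square_params_def by blast
      qed
      ultimately show ?thesis by simp
    qed
    moreover obtain k where k: "i = int (2 * k + 1)" "2 * k + 1 \<in> {1, 3, 5, 7 :: nat}"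
      using i that[of 0] that[of 1] that[of 2] that[of 3] by auto
    ultimately obtain w where w: "a m * s (2 * k + 1) + b m = w\<^sup>2" by blast
    define q where "q = t ^ (2 * k + 1)"
    have q: "q \<noteq> 0" using t by (simp add: q_def)
    have pos: "(t0 powi i) ^ n = q"
      unfolding k(1) power_int_of_nat q_def t_def by (simp only: power_mult[symmetric] mult.commute)
    hence neg: "(t0 powi (- i)) ^ n = inverse q" by (simp add: power_int_minus power_inverse)
    have w: "a m * (q + inverse q) + b m = w\<^sup>2" using w by (simp add: s_def q_def)
    hence w': "a m * (inverse q + inverse (inverse q)) + b m = w\<^sup>2" by (simp add: add.commute)
    have "t * q = (t ^ (k + 1))\<^sup>2"
      by (simp add: q_def power2_eq_square power_add mult_2)
    moreover have "t * inverse q = (inverse (t ^ k))\<^sup>2"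
      using t by (simp add: q_def power2_eq_square power_add mult_2 divide_inverse)
    ultimately show ?thesis
      using rational_point_if_square[OF pos q _ w] rational_point_if_square[OF neg _ _ w'] q
      by simp
  qed
  have distinct: "m = m'" if same: "same_curve (palindromic_trinomial n (t * a m) (t * b m))
      (palindromic_trinomial n (t * a m') (t * b m'))" for m m'
  proof -
    obtain c where "t * a m' = c\<^sup>2 * (t * a m)" "t * b m' = c\<^sup>2 * (t * b m)"
      using same_curve_palindromic_trinomial[OF _ same] assms(2) by auto
    hence c: "a m' = c\<^sup>2 * a m" "b m' = c\<^sup>2 * b m" using t by auto
    \<comment> \<open>The normalisation $a s_7 + b = 1$ leaves no room for a scaling.\<close>
    have "1 = b m' + a m' * s 7" by (simp add: b_def)
    also have "\<dots> = c\<^sup>2 * (b m + a m * s 7)" by (simp add: c algebra_simps)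
    also have "b m + a m * s 7 = 1" by (simp add: b_def)
    finally have "c\<^sup>2 = 1" by simp
    hence "z m = z m'" using c(1) C0 by (simp add: a_def)
    thus ?thesis by (rule z_inj)
  qed
  show ?thesis
  proof (rule exI[of _ "\<lambda>m. t * a m"], rule exI[of _ "\<lambda>m. t * b m"], intro conjI allI impI ballI)
    fix m m' :: int assume "m \<noteq> m'"
    thus "\<not> same_curve (palindromic_trinomial n (t * a m) (t * b m))
        (palindromic_trinomial n (t * a m') (t * b m'))"
      using distinct by (rule contrapos_nn)
  qed (use hyp points in blast)+
qed

end
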